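(* Let $\mathbb{E}_1,\mathbb{E}_2$ be Euclidean spaces, let $F:\mathbb{E}_1\to\mathbb{E}_2$ be continuous, and let $f:\mathbb{E}_1\to\mathbb{R}\cup\{+\infty\}$ and $g:\mathbb{E}_2\to\mathbb{R}\cup\{+\infty\}$ be closed (lower semicontinuous), proper, convex functions. Let $\alpha\in\mathbb{R}$ be such that $\mathrm{lev}_g(\alpha):=\{y\in\mathbb{E}_2 : g(y)\le\alpha\}\neq\emptyset$ and define the horizon cone of $g$ by $$\mathrm{hzn}\,g:=\{w\in\mathbb{E}_2 : y+tw\in \mathrm{lev}_g(\alpha)\ \text{for all } t\ge 0 \text{ and all } y\in \mathrm{lev}_g(\alpha)\}.$$ If $F$ is convex with respect to $-\mathrm{hzn}\,g$, i.e. $$F((1-\lambda)x_1+\lambda x_2)-[(1-\lambda)F(x_1)+\lambda F(x_2)]\in \mathrm{hzn}\,g\qquad \text{for all } x_1,x_2\in\mathbb{E}_1,\ \lambda\in[0,1],$$ then the function $\Phi:\mathbb{E}_1\to\mathbb{R}\cup\{+\infty\}$, $\Phi(x):=f(x)+g(F(x))$, is convex.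
   Context: A Euclidean space is a finite-dimensional real inner product space. An extended-real-valued function is proper if it never takes the value $-\infty$ and is not identically $+\infty$; it is closed if its epigraph is closed. *)

theory Defs
  imports "HOL-Analysis.Analysis"
begin

text \<open>
  Functions into the reals extended by plus infinity are total functions into \<^typ>\<open>ereal\<close>;
  the value minus infinity is excluded by \<open>proper_fun\<close>. The library's \<^const>\<open>epigraph\<close> only
  applies to real-valued functions. As there, the height coordinate below is a real number,
  so points of value plus infinity contribute nothing to the epigraph.
\<close>

definition epi :: "('a \<Rightarrow> ereal) \<Rightarrow> ('a \<times> real) set" where
  "epi h = {(x, r). h x \<le> ereal r}"

definition proper_fun :: "('a \<Rightarrow> ereal) \<Rightarrow> bool" where
  "proper_fun h \<longleftrightarrow> (\<forall>x. h x \<noteq> -\<infinity>) \<and> (\<exists>x. h x \<noteq> \<infinity>)"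

definition closed_fun :: "('a::topological_space \<Rightarrow> ereal) \<Rightarrow> bool" where
  "closed_fun h \<longleftrightarrow> closed (epi h)"

definition convex_fun :: "('a::real_vector \<Rightarrow> ereal) \<Rightarrow> bool" where
  "convex_fun h \<longleftrightarrow> convex (epi h)"

definition lev :: "('a \<Rightarrow> ereal) \<Rightarrow> real \<Rightarrow> 'a set" where
  "lev g \<alpha> = {y. g y \<le> ereal \<alpha>}"

definition hzn :: "('a::real_vector \<Rightarrow> ereal) \<Rightarrow> real \<Rightarrow> 'a set" where
  "hzn g \<alpha> = {w. \<forall>t\<ge>0. \<forall>y\<in>lev g \<alpha>. y + t *\<^sub>R w \<in> lev g \<alpha>}"

text \<open>
  A Euclidean space is a real inner product space spanned by a finite set. Unlike the class
  \<^class>\<open>euclidean_space\<close>, whose basis is nonempty, this includes the zero space.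
\<close>

definition finite_dim :: "'a::real_vector itself \<Rightarrow> bool" where
  "finite_dim _ \<longleftrightarrow> (\<exists>B::'a set. finite B \<and> span B = UNIV)"

end

theory Submission
  imports Defs
begin

text \<open>
  A horizon direction \<open>w\<close> of one level set of a closed convex function \<open>g\<close> does not increase \<open>g\<close>
  anywhere: for \<open>y\<close> in that level set, the epigraph point \<open>(z + w, r)\<close> is the limit, as \<open>s\<close> decreases
  to \<open>0\<close>, of the convex combinations of \<open>(z, r)\<close> and \<open>(y + w / s, \<alpha>)\<close> with weights \<open>1 - s\<close> and \<open>s\<close>.
  Hence the defect of linearity of \<open>F\<close> can be discarded in the convexity inequality for \<open>g \<circ> F\<close>.
\<close>

lemma epi_add_hzn:
  fixes g :: "'b::real_normed_vector \<Rightarrow> ereal"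
  assumes "closed_fun g" "convex_fun g" "lev g \<alpha> \<noteq> {}"
    and w: "w \<in> hzn g \<alpha>" and zr: "(z, r) \<in> epi g"
  shows "(z + w, r) \<in> epi g"
proof -
  obtain y where y: "y \<in> lev g \<alpha>" using assms(3) by blast
  \<comment> \<open>\<open>Suc n\<close> keeps the weight \<open>s n\<close> positive and at most 1,
    also at \<open>n = 0\<close>.\<close>
  define s where "s n = inverse (real (Suc n))" for n
  define p where "p n = ((1 - s n) *\<^sub>R z + s n *\<^sub>R y + w, (1 - s n) * r + s n * \<alpha>)" for n
  have lim: "s \<longlonglongrightarrow> 0" unfolding s_def by (rule LIMSEQ_inverse_real_of_nat)
  have "p n \<in> epi g" for n
  proof -
    have s: "0 < s n" "s n \<le> 1" by (auto simp: s_def field_simps)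
    have "y + inverse (s n) *\<^sub>R w \<in> lev g \<alpha>"
      using w y s unfolding hzn_def by simp
    then have "(y + inverse (s n) *\<^sub>R w, \<alpha>) \<in> epi g"
      by (simp add: epi_def lev_def)
    \<comment> \<open>The weight \<open>s n\<close> cancels the factor \<open>inverse (s n)\<close>,
      so \<open>w\<close> keeps coefficient 1 while the share of \<open>y\<close> tends to
      0.\<close>
    then have "(1 - s n) *\<^sub>R (z, r) + s n *\<^sub>R (y + inverse (s n) *\<^sub>R w, \<alpha>) \<in> epi g"
      using assms(2) zr s unfolding convex_fun_def by (intro convexD_alt) auto
    with s show ?thesis by (simp add: p_def algebra_simps)
  qed
  moreover have "p \<longlonglongrightarrow> ((1 - 0) *\<^sub>R z + 0 *\<^sub>R y + w, (1 - 0) * r + 0 * \<alpha>)"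
    unfolding p_def by (intro tendsto_intros lim)
  ultimately show ?thesis
    using assms(1) closed_sequentially[of "epi g" p] unfolding closed_fun_def by simp
qed

text \<open>A real bound on the sum, with -\<infinity> excluded, makes both values finite;
  \<open>k\<close> then takes all the slack. Convexity of the two summands can thus be applied
  separately.\<close>

lemma epi_plusE:
  assumes "(x, r) \<in> epi (\<lambda>x. h x + k x)" "h x \<noteq> -\<infinity>" "k x \<noteq> -\<infinity>"
  obtains a b where "(x, a) \<in> epi h" "(x, b) \<in> epi k" "a + b = r"
proof -
  from assms obtain a b where ab: "h x = ereal a" "k x = ereal b"
    by (cases "h x"; cases "k x") (auto simp: epi_def)
  show ?thesis
    by (rule that[of a "r - a"]) (use assms ab in \<open>auto simp: epi_def\<close>)
qed

theorem theorem1: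
  fixes F :: "'a::real_inner \<Rightarrow> 'b::real_inner"
    and f :: "'a \<Rightarrow> ereal"
    and g :: "'b \<Rightarrow> ereal"
    and \<alpha> :: real
  assumes "finite_dim TYPE('a)" and "finite_dim TYPE('b)"
    and "continuous_on UNIV F"
    and "closed_fun f" and "proper_fun f" and "convex_fun f"
    and "closed_fun g" and "proper_fun g" and "convex_fun g"
    and "lev g \<alpha> \<noteq> {}"
    and "\<And>x1 x2 t. t \<in> {0..1} \<Longrightarrow>
           F ((1 - t) *\<^sub>R x1 + t *\<^sub>R x2) - ((1 - t) *\<^sub>R F x1 + t *\<^sub>R F x2) \<in> hzn g \<alpha>"
  shows "convex_fun (\<lambda>x. f x + g (F x))"
  unfolding convex_fun_def convex_alt
proof (intro ballI allI impI, clarify)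
  fix x1 r1 x2 r2 and t :: real
  assume 1: "(x1, r1) \<in> epi (\<lambda>x. f x + g (F x))"
    and 2: "(x2, r2) \<in> epi (\<lambda>x. f x + g (F x))"
    and t: "0 \<le> t" "t \<le> 1"
  let ?x = "(1 - t) *\<^sub>R x1 + t *\<^sub>R x2"
  have ninf: "f x \<noteq> -\<infinity>" "g y \<noteq> -\<infinity>" for x y
    using assms(5,8) by (auto simp: proper_fun_def)
  obtain a1 b1 where 1: "(x1, a1) \<in> epi f" "(F x1, b1) \<in> epi g" "a1 + b1 = r1"
    using epi_plusE[OF 1] ninf by (auto simp: epi_def)
  obtain a2 b2 where 2: "(x2, a2) \<in> epi f" "(F x2, b2) \<in> epi g" "a2 + b2 = r2"
    using epi_plusE[OF 2] ninf by (auto simp: epi_def)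
  have "(?x, (1 - t) * a1 + t * a2) \<in> epi f"
    using convexD_alt[OF assms(6)[unfolded convex_fun_def] 1(1) 2(1) t] by simp
  moreover have "((1 - t) *\<^sub>R F x1 + t *\<^sub>R F x2, (1 - t) * b1 + t * b2) \<in> epi g"
    using convexD_alt[OF assms(9)[unfolded convex_fun_def] 1(2) 2(2) t] by simp
  \<comment> \<open>\<open>F ?x\<close> is this combination of \<open>F x1\<close> and
    \<open>F x2\<close> plus a horizon direction, so the same height still bounds \<open>g\<close>
    there.\<close>
  with epi_add_hzn[OF assms(7,9,10) assms(11)[of t x1 x2]] t
  have "(F ?x, (1 - t) * b1 + t * b2) \<in> epi g" by fastforce
  ultimately have "f ?x + g (F ?x) \<le> ereal ((1 - t) * a1 + t * a2) + ereal ((1 - t) * b1 + t * b2)"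
    unfolding epi_def by (intro add_mono) auto
  also have "\<dots> = ereal ((1 - t) * r1 + t * r2)"
    using 1(3) 2(3) by (auto simp: algebra_simps)
  finally show "(1 - t) *\<^sub>R (x1, r1) + t *\<^sub>R (x2, r2) \<in> epi (\<lambda>x. f x + g (F x))"
    by (simp add: epi_def)
qed

end
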